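(* Let $\mathbb F_q$ be a finite field, $t,n$ positive integers with $n<\frac{t-1}{2}$, and $d_1>\cdots>d_t\ge 2$ integers not divisible by $\mathrm{char}(\mathbb F_q)$. Let $c_{ji}$ ($1\le i,j\le n$) be positive integers with $c_{j1}+\cdots+c_{jn}<d_t$ for each $j$. Let $A=(a_{ji})\in\mathbb F_q^{n\times t}$ satisfy hypothesis (H), let $a_1,\dots,a_n\in\mathbb F_q$ with $a_j\ne 0$ for some $j$, and $b_1,\dots,b_n\in\mathbb F_q\setminus\{0\}$. Then the number $N$ of solutions in $\mathbb F_q^t$ of the system $$\sum_{i=1}^t a_{ji}X_i^{d_i}+a_j=b_jX_1^{c_{j1}}\cdots X_n^{c_{jn}},\qquad 1\le j\le n,$$ satisfies $\big|N-q^{t-n}\big|\le q^{t/2}(6n d_1)^{t+1}$.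
   Context: Hypothesis (H) on $A\in\mathbb F_q^{n\times t}$: every $n\times n$ submatrix of $A$ (formed by any choice of $n$ columns) has rank $n$. *)

theory Defs
  imports Complex_Main "Jordan_Normal_Form.DL_Rank"
begin

text \<open>The n x n submatrix of the n x t matrix A = (A j i), 1 <= j <= n, 1 <= i <= t,
  formed by the columns in the set S (taken in increasing order).\<close>
definition submat_cols :: "nat \<Rightarrow> (nat \<Rightarrow> nat \<Rightarrow> 'a) \<Rightarrow> nat set \<Rightarrow> 'a mat" where
  "submat_cols n A S = mat n n (\<lambda>(j, i). A (j + 1) (sorted_list_of_set S ! i))"

definition hyp_H :: "nat \<Rightarrow> nat \<Rightarrow> (nat \<Rightarrow> nat \<Rightarrow> 'a::field) \<Rightarrow> bool" where
  "hyp_H n t A \<longleftrightarrow>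
     (\<forall>S. S \<subseteq> {1..t} \<and> card S = n \<longrightarrow> vec_space.rank n (submat_cols n A S) = n)"

definition num_solutions ::
  "nat \<Rightarrow> nat \<Rightarrow> (nat \<Rightarrow> nat \<Rightarrow> 'a::{finite,field}) \<Rightarrow> (nat \<Rightarrow> nat) \<Rightarrow> (nat \<Rightarrow> 'a) \<Rightarrow>
     (nat \<Rightarrow> 'a) \<Rightarrow> (nat \<Rightarrow> nat \<Rightarrow> nat) \<Rightarrow> nat" where
  "num_solutions n t A d a b c = card {x \<in> PiE {1..t} (\<lambda>_. UNIV).
      \<forall>j\<in>{1..n}. (\<Sum>i=1..t. A j i * x i ^ d i) + a j = b j * (\<Prod>i=1..n. x i ^ c j i)}"

end

theory Submission
  imports Defs "HOL-Analysis.Convex" "HOL-Library.Cardinality"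
begin

text \<open>Detecting the $n$ equations with a nontrivial additive character $\psi$ gives
  $q^n N = \sum_u \psi(u \cdot a) S(u) P(u)$, where $S(u)$ is the sum over the coupled variables
  $x_1,\dots,x_n$, and $P(u)$ is a product over $i > n$ of sums
  $\sum_y \psi(L_i(u) y^{d_i})$ with $L_i(u) = \sum_j u_j a_{ji}$.
  The term $u = 0$ is the main term $q^t$, and Cauchy-Schwarz splits the rest into the second
  moments of $S$ and $P$.
  For $S$, the second moment counts pairs with equal image under
  $x \mapsto (\sum_{i \le n} a_{ji} x_i^{d_i} - b_j x^{c_j})_j$, a map whose fibres have at most
  $d_1 \cdots d_n$ points because $\deg x^{c_j} < d_i$.
  For $P$, each factor with $L_i(u) \ne 0$ is $O(d_i \sqrt q)$, and by (H) the loss of $\sqrt q$ from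
  each vanishing $L_i(u)$ is balanced by the codimension of the set of such $u$.\<close>

section \<open>Additive subgroups and the existence of a nontrivial additive character\<close>

definition add_subgroup :: "'a::ab_group_add set \<Rightarrow> bool" where
  "add_subgroup H \<longleftrightarrow> 0 \<in> H \<and> (\<forall>x\<in>H. \<forall>y\<in>H. x - y \<in> H)"

lemma add_subgroup_add: "add_subgroup H \<Longrightarrow> x \<in> H \<Longrightarrow> y \<in> H \<Longrightarrow> x + y \<in> H"
  unfolding add_subgroup_def by (metis diff_0 diff_minus_eq_add)

lemma add_subgroup_of_int_mult:
  fixes H :: "'a::ring_1 set"
  assumes H: "add_subgroup H" and x: "x \<in> H"
  shows "of_int k * x \<in> H"
proof -
  have nat: "of_nat m * x \<in> H" for m
  proof (induction m)
    case 0
    then show ?case using H by (simp add: add_subgroup_def)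
  next
    case (Suc m)
    then show ?case using add_subgroup_add[OF H x] by (simp add: distrib_right)
  qed
  show ?thesis
  proof (cases k)
    case (nonneg m)
    then show ?thesis using nat by simp
  next
    case (neg m)
    have "0 - of_nat (Suc m) * x \<in> H" using nat[of "Suc m"] H unfolding add_subgroup_def by blast
    moreover have "of_int k * x = 0 - of_nat (Suc m) * x" unfolding neg by (simp add: algebra_simps)
    ultimately show ?thesis by simp
  qed
qed

text \<open>The norm condition excludes the zero function, which would satisfy the other two axioms,
  and turns inverses into complex conjugates.\<close>

locale additive_character =
  fixes \<psi> :: "'a::{finite,field} \<Rightarrow> complex"
  assumes add: "\<psi> (x + y) = \<psi> x * \<psi> y"
    and norm_eq_1 [simp]: "norm (\<psi> x) = 1"
    and nontrivial: "\<exists>x. \<psi> x \<noteq> 1"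

text \<open>With $H$ a maximal proper subgroup and $g \notin H$, the character is
  $h + k g \mapsto e^{2 \pi i k / p}$; this avoids the trace map to the prime field.\<close>
lemma additive_character_exists:
  "\<exists>\<psi> :: 'a::{finite,field} \<Rightarrow> complex. additive_character \<psi>"
proof -
  define p where "p = CHAR('a)"
  have p: "prime p"
    using prime_CHAR_semidom[where ?'a='a] finite_imp_CHAR_pos[where ?'a='a] by (simp add: p_def)
  have p1: "p > 1" using p prime_gt_1_nat by blast
  have char0: "of_int (int p) = (0::'a)" by (simp add: p_def)
  let ?S = "{H::'a set. add_subgroup H \<and> H \<noteq> UNIV}"
  have "{0} \<in> ?S"
    by (auto simp: add_subgroup_def) (metis UNIV_I singletonD zero_neq_one)
  then obtain H where H: "H \<in> ?S" and max: "\<And>K. K \<in> ?S \<Longrightarrow> H \<subseteq> K \<Longrightarrow> K = H"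
    using finite_has_maximal[of ?S] finite[of ?S] by blast
  have sub: "add_subgroup H" using H by simp
  obtain g where g: "g \<notin> H" using H by auto
  \<comment> \<open>The subgroup generated by \<open>H\<close> and \<open>g\<close> is strictly
    larger than \<open>H\<close>, so by maximality it is the whole field.\<close>
  have "\<exists>k::int. x - of_int k * g \<in> H" for x
  proof -
    let ?K = "{x. \<exists>k::int. x - of_int k * g \<in> H}"
    have K: "add_subgroup ?K"
      unfolding add_subgroup_def
    proof safe
      show "\<exists>k::int. 0 - of_int k * g \<in> H"
        using sub by (intro exI[of _ 0]) (simp add: add_subgroup_def)
    next
      fix x y and k l :: int
      assume "x - of_int k * g \<in> H" "y - of_int l * g \<in> H"
      then have "(x - of_int k * g) - (y - of_int l * g) \<in> H"
        using sub unfolding add_subgroup_def by blast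
      moreover have "(x - of_int k * g) - (y - of_int l * g) = x - y - of_int (k - l) * g"
        by (simp add: algebra_simps)
      ultimately show "\<exists>m::int. x - y - of_int m * g \<in> H" by metis
    qed
    have "H \<subseteq> ?K" by (auto intro!: exI[of _ "0::int"])
    moreover have "g \<in> ?K"
      using sub by (auto intro!: exI[of _ "1::int"] simp: add_subgroup_def)
    ultimately have "?K \<notin> ?S" using max[of ?K] g by blast
    with K have "?K = UNIV" by simp
    then show ?thesis by blast
  qed
  then obtain k :: "'a \<Rightarrow> int" where k: "\<And>x. x - of_int (k x) * g \<in> H" by metis
  \<comment> \<open>If \<open>p\<close> did not divide \<open>m\<close>, Bezout's identity and
    \<open>p = 0\<close> in the field would make \<open>g\<close> an integer multiple of
    \<open>of_int m * g\<close>, hence an element of \<open>H\<close>.\<close>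
  have dvd: "int p dvd m" if "of_int m * g \<in> H" for m
  proof (rule ccontr)
    assume "\<not> int p dvd m"
    then have "coprime (int p) m" using p by (intro prime_imp_coprime) auto
    then have "gcd m (int p) = 1" by (simp add: coprime_iff_gcd_eq_1 gcd.commute)
    then obtain u v where "u * m + v * int p = 1" using bezout_int[of m "int p"] by auto
    then have "of_int (u * m + v * int p) * g = g" by simp
    then have "of_int u * (of_int m * g) = g" using char0 by (simp add: algebra_simps)
    then show False using add_subgroup_of_int_mult[OF sub that, of u] g by metis
  qed
  define e where "e m = cis (2 * pi * (of_int m / of_nat p))" for m :: int
  have e_add: "e (m + m') = e m * e m'" for m m'
    by (simp add: e_def cis_mult add_divide_distrib distrib_left)
  have e_cong: "e m = e m'" if dvd_diff: "int p dvd m - m'" for m m'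
  proof -
    obtain r where "m - m' = int p * r" using dvd_diff by blast
    then have m: "m = m' + int p * r" by simp
    have "e (int p * r) = 1" using p1 by (simp add: e_def)
    then show ?thesis unfolding m e_add by simp
  qed
  \<comment> \<open>The coefficient \<open>k x\<close> is an arbitrary choice, unique only modulo
    \<open>p\<close>. Since \<open>e\<close> has period \<open>p\<close>, any other admissible
    coefficient gives the same value, which is what makes the map multiplicative.\<close>
  have ek: "e (k x) = e m" if "x - of_int m * g \<in> H" for x m
  proof (rule e_cong, rule dvd)
    have "(x - of_int m * g) - (x - of_int (k x) * g) \<in> H"
      using sub that k[of x] unfolding add_subgroup_def by blast
    then show "of_int (k x - m) * g \<in> H" by (simp add: algebra_simps)
  qed
  have "additive_character (\<lambda>x. e (k x))"
  proof
    fix x y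
    have "(x - of_int (k x) * g) + (y - of_int (k y) * g) \<in> H"
      using add_subgroup_add[OF sub] k by blast
    then have "x + y - of_int (k x + k y) * g \<in> H" by (simp add: algebra_simps)
    then show "e (k (x + y)) = e (k x) * e (k y)" using ek e_add by metis
  next
    show "norm (e (k x)) = 1" for x by (simp add: e_def)
  next
    have "e (k g) = e 1"
      using sub by (intro ek) (simp add: add_subgroup_def)
    moreover have "e 1 \<noteq> 1"
    proof
      assume "e 1 = 1"
      then have "cos (2 * pi * (1 / real p)) = 1" by (simp add: e_def complex_eq_iff)
      then obtain r :: int where "2 * pi * (1 / real p) = of_int r * 2 * pi"
        using cos_one_2pi_int by blast
      then have "1 = real_of_int r * real p" using p1 by (simp add: field_simps)
      then have "1 = r * int p" by (metis of_int_1 of_int_eq_iff of_int_mult of_int_of_nat_eq)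
      then show False using p1 by (metis dvd_triv_right nat_dvd_1_iff_1 int_dvd_int_iff less_irrefl of_nat_1)
    qed
    ultimately show "\<exists>x. e (k x) \<noteq> 1" by metis
  qed
  then show ?thesis by blast
qed

section \<open>Orthogonality relations and a general second moment estimate\<close>

context additive_character
begin

lemma zero [simp]: "\<psi> 0 = 1"
  using add[of 0 0] norm_eq_1[of 0] by (metis add_0 mult_cancel_left2 norm_zero zero_neq_one)

lemma minus: "\<psi> (- x) = cnj (\<psi> x)"
proof -
  have "\<psi> x * \<psi> (- x) = 1" using add[of x "- x"] by simp
  moreover have "\<psi> x * cnj (\<psi> x) = 1" by (simp add: complex_norm_square[symmetric])
  ultimately show ?thesis by (metis mult_cancel_left mult_zero_left zero_neq_one)
qed

lemma diff: "\<psi> (x - y) = \<psi> x * cnj (\<psi> y)"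
  using add[of x "- y"] minus by simp

lemma sum_eq_prod: "\<psi> (\<Sum>i\<in>I. f i) = (\<Prod>i\<in>I. \<psi> (f i))"
  by (induction I rule: infinite_finite_induct) (auto simp: add)

lemma orthogonality: "(\<Sum>u\<in>UNIV. \<psi> (u * x)) = (if x = 0 then of_nat CARD('a) else 0)"
proof (cases "x = 0")
  case False
  obtain w where w: "\<psi> w \<noteq> 1" using nontrivial by blast
  \<comment> \<open>Shifting \<open>u\<close> by \<open>w / x\<close> permutes the field and
    multiplies the sum by \<open>\<psi> w\<close>, which differs from 1, so the sum must
    vanish.\<close>
  have "(\<Sum>u\<in>UNIV. \<psi> (u * x)) = (\<Sum>u\<in>UNIV. \<psi> ((u + w / x) * x))"
    by (rule sum.reindex_bij_witness[of _ "\<lambda>u. u + w / x" "\<lambda>u. u - w / x"]) auto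
  also have "\<dots> = \<psi> w * (\<Sum>u\<in>UNIV. \<psi> (u * x))"
  proof -
    have "(u + w / x) * x = w + u * x" for u using False by (simp add: distrib_right)
    then show ?thesis by (simp add: add sum_distrib_left)
  qed
  finally show ?thesis using w False by simp
qed simp

lemma orthogonality_PiE:
  assumes "finite J"
  shows "(\<Sum>u\<in>PiE J (\<lambda>_. UNIV). \<psi> (\<Sum>j\<in>J. u j * v j)) =
    (if \<forall>j\<in>J. v j = 0 then of_nat CARD('a) ^ card J else 0)"
proof -
  have "(\<Sum>u\<in>PiE J (\<lambda>_. UNIV). \<psi> (\<Sum>j\<in>J. u j * v j)) = (\<Prod>j\<in>J. \<Sum>u\<in>UNIV. \<psi> (u * v j))"
    unfolding sum_eq_prod using assms by (intro prod_sum_PiE[symmetric]) auto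
  then show ?thesis unfolding orthogonality using assms by (auto simp: prod_zero_iff)
qed

text \<open>Expanding the square gives a sum over pairs \<open>(x, y)\<close>; after summation over
  \<open>u\<close> first, only the pairs related by \<open>R\<close> survive, each with weight
  \<open>Q\<close>, and every \<open>x\<close> has at most \<open>D\<close> partners. The relation
  is left abstract so that the estimate serves both one-variable power sums and the coupled sum in
  \<open>n\<close> variables.\<close>

lemma second_moment_le:
  assumes fin: "finite U" "finite X" and Q: "Q \<ge> 0"
    and orth: "\<And>x y. x \<in> X \<Longrightarrow> y \<in> X \<Longrightarrow>
      (\<Sum>u\<in>U. \<psi> (f u x - f u y)) = of_real (if R x y then Q else 0)"
    and fibre: "\<And>x. x \<in> X \<Longrightarrow> card {y\<in>X. R x y} \<le> D"
  shows "(\<Sum>u\<in>U. (norm (\<Sum>x\<in>X. \<psi> (f u x)))\<^sup>2) \<le> Q * real D * real (card X)"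
proof -
  have "complex_of_real (\<Sum>u\<in>U. (norm (\<Sum>x\<in>X. \<psi> (f u x)))\<^sup>2) =
      (\<Sum>u\<in>U. \<Sum>x\<in>X. \<Sum>y\<in>X. \<psi> (f u x - f u y))"
    by (simp only: of_real_sum complex_norm_square diff sum_product cnj_sum)
  also have "\<dots> = (\<Sum>x\<in>X. \<Sum>u\<in>U. \<Sum>y\<in>X. \<psi> (f u x - f u y))" by (rule sum.swap)
  also have "\<dots> = (\<Sum>x\<in>X. \<Sum>y\<in>X. \<Sum>u\<in>U. \<psi> (f u x - f u y))" by (intro sum.cong refl sum.swap)
  also have "\<dots> = (\<Sum>x\<in>X. \<Sum>y\<in>X. of_real (if R x y then Q else 0))"
    using orth by (intro sum.cong refl) auto
  also have "\<dots> = complex_of_real (\<Sum>x\<in>X. \<Sum>y\<in>X. if R x y then Q else 0)" by simp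
  finally have "(\<Sum>u\<in>U. (norm (\<Sum>x\<in>X. \<psi> (f u x)))\<^sup>2) = (\<Sum>x\<in>X. \<Sum>y\<in>X. if R x y then Q else 0)"
    by (simp only: of_real_eq_iff)
  also have "\<dots> = (\<Sum>x\<in>X. Q * real (card {y\<in>X. R x y}))"
    using fin by (intro sum.cong refl) (simp add: sum.If_cases Int_def)
  also have "\<dots> \<le> (\<Sum>x\<in>X. Q * real D)"
    using fibre Q by (intro sum_mono mult_left_mono) auto
  finally show ?thesis by (simp add: mult_ac)
qed

end

section \<open>Power equations and power sums in one variable\<close>

lemma card_power_eq_le:
  fixes s :: "'a::field"
  assumes "d > 0"
  shows "card {y. y ^ d = s} \<le> d"
proof -
  let ?p = "monom 1 d + [:- s:]"
  have "degree ?p = d" using assms by (subst degree_add_eq_left) (auto simp: degree_monom_eq)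
  moreover from this have "?p \<noteq> 0" using assms by auto
  then have "card {x. poly ?p x = 0} \<le> degree ?p" by (rule card_poly_roots_bound)
  ultimately show ?thesis by (simp add: poly_monom)
qed

text \<open>The sum depends only on the class of $L$ modulo $d$-th powers, and these classes are so
  large that the second moment over all $L$ controls every single sum.\<close>
lemma (in additive_character) power_sum_bound:
  assumes L: "L \<noteq> 0" and d: "d > 0"
  shows "(norm (\<Sum>y\<in>UNIV. \<psi> (L * y ^ d)))\<^sup>2 \<le> 2 * (real d)\<^sup>2 * real CARD('a)"
proof -
  define G where "G s = (norm (\<Sum>y\<in>UNIV. \<psi> (s * y ^ d)))\<^sup>2" for s
  let ?q = "real CARD('a)"
  have q2: "CARD('a) \<ge> 2"
  proof -
    have "card {0::'a, 1} \<le> CARD('a)" by (intro card_mono) auto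
    then show ?thesis by simp
  qed
  have G0: "G s \<ge> 0" for s by (simp add: G_def)
  have "(\<Sum>s\<in>UNIV. G s) \<le> ?q * real d * real (card (UNIV :: 'a set))"
    unfolding G_def
  proof (rule second_moment_le[where R = "\<lambda>x y. x ^ d = y ^ d"])
    show "(\<Sum>u\<in>UNIV. \<psi> (u * x ^ d - u * y ^ d)) = of_real (if x ^ d = y ^ d then ?q else 0)" for x y
      unfolding right_diff_distrib[symmetric] orthogonality by simp
    show "card {y \<in> UNIV. x ^ d = y ^ d} \<le> d" for x :: 'a
      using card_power_eq_le[OF d, of "x ^ d"] by (simp add: eq_commute)
  qed auto
  then have total: "(\<Sum>s\<in>UNIV. G s) \<le> real d * ?q\<^sup>2" by (simp add: power2_eq_square mult_ac)
  \<comment> \<open>Replacing \<open>y\<close> by \<open>y / z\<close> absorbs the factor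
    \<open>z ^ d\<close>.\<close>
  have inv: "G (L * z ^ d) = G L" if "z \<noteq> 0" for z
  proof -
    have "(\<Sum>y\<in>UNIV. \<psi> (L * z ^ d * y ^ d)) = (\<Sum>y\<in>UNIV. \<psi> (L * y ^ d))"
      using that by (intro sum.reindex_bij_witness[of _ "\<lambda>y. y / z" "\<lambda>y. z * y"])
        (auto simp: power_mult_distrib mult_ac)
    then show ?thesis by (simp add: G_def)
  qed
  let ?Z = "UNIV - {0::'a}"
  \<comment> \<open>The value \<open>G L\<close> is averaged over all nonzero \<open>z\<close>. Each
    coefficient \<open>s\<close> arises as \<open>L * z ^ d\<close> for at most \<open>d\<close>
    values of \<open>z\<close>, so the average is bounded by the total second moment.\<close>
  have "(?q - 1) * G L = (\<Sum>z\<in>?Z. G (L * z ^ d))"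
    using inv q2 by (simp add: card_Diff_singleton of_nat_diff)
  also have "\<dots> = (\<Sum>s\<in>UNIV. \<Sum>z\<in>{z\<in>?Z. L * z ^ d = s}. G (L * z ^ d))"
    by (rule sum.group[symmetric]) auto
  also have "\<dots> = (\<Sum>s\<in>UNIV. real (card {z\<in>?Z. L * z ^ d = s}) * G s)"
    by (intro sum.cong refl) simp
  also have "\<dots> \<le> (\<Sum>s\<in>UNIV. real d * G s)"
  proof (intro sum_mono mult_right_mono G0)
    fix s
    have "card {z\<in>?Z. L * z ^ d = s} \<le> card {z. z ^ d = s / L}"
      using L by (intro card_mono) (auto simp: field_simps)
    then show "real (card {z\<in>?Z. L * z ^ d = s}) \<le> real d"
      using card_power_eq_le[OF d, of "s / L"] by linarith
  qed
  also have "\<dots> \<le> real d * (real d * ?q\<^sup>2)"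
    unfolding sum_distrib_left[symmetric] using total by (intro mult_left_mono) auto
  also have "\<dots> = (real d)\<^sup>2 * ?q\<^sup>2" by (simp add: power2_eq_square)
  finally have "(?q - 1) * G L \<le> (real d)\<^sup>2 * ?q\<^sup>2" .
  \<comment> \<open>The factor 2 in the final bound comes from replacing \<open>q - 1\<close> by
    \<open>q / 2\<close>.\<close>
  moreover have "?q / 2 * G L \<le> (?q - 1) * G L"
    using q2 by (intro mult_right_mono G0) simp
  ultimately have "?q / 2 * G L \<le> (real d)\<^sup>2 * ?q\<^sup>2" by (rule order_trans[rotated])
  then have "?q * G L \<le> ?q * (2 * (real d)\<^sup>2 * ?q)"
    by (simp add: power2_eq_square mult_ac)
  then show ?thesis using q2 unfolding G_def by (subst (asm) mult_le_cancel_left_pos) auto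
qed

section \<open>Counting the solutions of a system with dominant pure powers\<close>

text \<open>A monomial whose exponent of some $x_i$ is at least $d_i$ can be rewritten on $Z$ by
  monomials of smaller total degree. Hence every function on $Z$ is a combination of the
  $\prod_i d_i$ reduced monomials, and counting functions bounds the size of $Z$.\<close>
lemma card_solutions_le_prod:
  fixes Z :: "('i \<Rightarrow> 'a::{finite,field}) set" and c :: "'j \<Rightarrow> 'i \<Rightarrow> nat"
  assumes I: "finite I" and J: "finite J" and d: "\<And>i. i \<in> I \<Longrightarrow> d i > 0"
    and Z: "Z \<subseteq> PiE I (\<lambda>_. UNIV)"
    and eq: "\<And>x i. x \<in> Z \<Longrightarrow> i \<in> I \<Longrightarrow>
      x i ^ d i = v i + (\<Sum>j\<in>J. \<gamma> i j * (\<Prod>l\<in>I. x l ^ c j l))"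
    and deg: "\<And>i j. i \<in> I \<Longrightarrow> j \<in> J \<Longrightarrow> (\<Sum>l\<in>I. c j l) < d i"
  shows "card Z \<le> (\<Prod>i\<in>I. d i)"
proof -
  define mono :: "('i \<Rightarrow> nat) \<Rightarrow> ('i \<Rightarrow> 'a) \<Rightarrow> 'a" where "mono e x = (\<Prod>l\<in>I. x l ^ e l)" for e x
  define E where "E = PiE I (\<lambda>i. {..<d i})"
  \<comment> \<open>Only the values on \<open>Z\<close> matter for membership in \<open>W\<close>;
    this is what allows the equations of \<open>Z\<close> to be used for rewriting.\<close>
  define W where "W = {f. \<exists>\<kappa>. \<forall>x\<in>Z. f x = (\<Sum>e\<in>E. \<kappa> e * mono e x)}"
  have finE: "finite E" unfolding E_def using I by (intro finite_PiE) auto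
  have finZ: "finite Z" using Z I by (meson finite_PiE finite finite_subset)
  have cong: "f \<in> W" if "g \<in> W" "\<And>x. x \<in> Z \<Longrightarrow> f x = g x" for f g
    using that unfolding W_def by auto
  have add: "(\<lambda>x. f x + g x) \<in> W" if "f \<in> W" "g \<in> W" for f g
  proof -
    from that obtain \<kappa> \<kappa>' where "\<forall>x\<in>Z. f x = (\<Sum>e\<in>E. \<kappa> e * mono e x)"
      "\<forall>x\<in>Z. g x = (\<Sum>e\<in>E. \<kappa>' e * mono e x)" unfolding W_def by blast
    then show ?thesis unfolding W_def
      by (intro CollectI exI[of _ "\<lambda>e. \<kappa> e + \<kappa>' e"]) (simp add: sum.distrib distrib_right)
  qed
  have scale: "(\<lambda>x. r * f x) \<in> W" if "f \<in> W" for f r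
  proof -
    from that obtain \<kappa> where "\<forall>x\<in>Z. f x = (\<Sum>e\<in>E. \<kappa> e * mono e x)" unfolding W_def by blast
    then show ?thesis unfolding W_def
      by (intro CollectI exI[of _ "\<lambda>e. r * \<kappa> e"]) (simp add: sum_distrib_left mult_ac)
  qed
  have zero: "(\<lambda>x. 0) \<in> W" unfolding W_def by (auto intro!: exI[of _ "\<lambda>_. 0"])
  have sum: "(\<lambda>x. \<Sum>s\<in>S. f s x) \<in> W" if "finite S" "\<And>s. s \<in> S \<Longrightarrow> f s \<in> W"
    for S :: "'s set" and f
    using that by (induction S rule: finite_induct) (auto intro: zero add)
  have mono_W: "mono e \<in> W" for e
  proof (induction "\<Sum>l\<in>I. e l" arbitrary: e rule: less_induct)
    case less
    show ?case
    proof (cases "\<forall>i\<in>I. e i < d i")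
      case True
      \<comment> \<open>Elements of \<open>E\<close> are undefined outside \<open>I\<close>, so the
        exponent vector has to be restricted before it can index a reduced monomial.\<close>
      have "restrict e I \<in> E" using True by (auto simp: E_def)
      moreover have "mono e x = mono (restrict e I) x" for x
        unfolding mono_def by (intro prod.cong) auto
      ultimately have "mono e x = (\<Sum>e'\<in>E. (if e' = restrict e I then 1 else 0) * mono e' x)" for x
        using finE by (simp add: if_distrib[of "\<lambda>z. z * _"] cong: if_cong)
      then show ?thesis unfolding W_def
        by (intro CollectI exI[of _ "\<lambda>e'. if e' = restrict e I then 1 else 0"]) simp
    next
      case False
      then obtain i where i: "i \<in> I" "e i \<ge> d i" by (auto simp: not_less)
      define e' where "e' = e(i := e i - d i)"
      have deg_e: "(\<Sum>l\<in>I. e l) = d i + (\<Sum>l\<in>I. e' l)"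
      proof -
        have "(\<Sum>l\<in>I. e l) = e i + (\<Sum>l\<in>I-{i}. e l)" "(\<Sum>l\<in>I. e' l) = e' i + (\<Sum>l\<in>I-{i}. e' l)"
          using I i by (auto intro: sum.remove)
        moreover have "(\<Sum>l\<in>I-{i}. e l) = (\<Sum>l\<in>I-{i}. e' l)"
          by (intro sum.cong) (auto simp: e'_def)
        moreover have "e i = d i + e' i" using i by (simp add: e'_def)
        ultimately show ?thesis by linarith
      qed
      have mono_e: "mono e x = x i ^ d i * mono e' x" for x
      proof -
        have "mono e x = x i ^ e i * (\<Prod>l\<in>I-{i}. x l ^ e l)"
          "mono e' x = x i ^ e' i * (\<Prod>l\<in>I-{i}. x l ^ e' l)"
          unfolding mono_def using I i by (auto intro: prod.remove)
        moreover have "(\<Prod>l\<in>I-{i}. x l ^ e l) = (\<Prod>l\<in>I-{i}. x l ^ e' l)"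
          by (intro prod.cong) (auto simp: e'_def)
        moreover have "x i ^ e i = x i ^ d i * x i ^ e' i"
          using i by (simp add: e'_def power_add[symmetric])
        ultimately show ?thesis by (simp only: mult.assoc)
      qed
      \<comment> \<open>The factor \<open>x i ^ d i\<close> is replaced by the right-hand side of
        its equation. Both kinds of resulting monomials have smaller total degree: the first loses
        \<open>d i > 0\<close>, the others trade \<open>d i\<close> for the degree of
        \<open>c j\<close>, which is below \<open>d i\<close>.\<close>
      let ?f = "\<lambda>x. v i * mono e' x + (\<Sum>j\<in>J. \<gamma> i j * mono (\<lambda>l. c j l + e' l) x)"
      have "?f \<in> W"
      proof (intro add scale sum J)
        show "mono e' \<in> W" using d[OF i(1)] deg_e by (intro less) simp
        fix j assume j: "j \<in> J"
        show "mono (\<lambda>l. c j l + e' l) \<in> W"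
          using deg[OF i(1) j] deg_e by (intro less) (simp add: sum.distrib)
      qed
      moreover have "mono e x = ?f x" if "x \<in> Z" for x
        unfolding mono_e eq[OF that i(1)]
        by (simp add: mono_def power_add prod.distrib distrib_left sum_distrib_left mult_ac)
      ultimately show ?thesis by (rule cong)
    qed
  qed
  have mult_var: "(\<lambda>x. (x i - s) * f x) \<in> W" if i: "i \<in> I" and f: "f \<in> W" for i s f
  proof -
    from f obtain \<kappa> where \<kappa>: "\<forall>x\<in>Z. f x = (\<Sum>e\<in>E. \<kappa> e * mono e x)" unfolding W_def by blast
    have var: "x i * mono e x = mono (e(i := Suc (e i))) x" for e x
    proof -
      have "mono e x = x i ^ e i * (\<Prod>l\<in>I-{i}. x l ^ e l)"
        unfolding mono_def using I i by (intro prod.remove)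
      moreover have "mono (e(i := Suc (e i))) x = x i ^ Suc (e i) * (\<Prod>l\<in>I-{i}. x l ^ (e(i := Suc (e i))) l)"
        unfolding mono_def using I i by (subst prod.remove) auto
      moreover have "(\<Prod>l\<in>I-{i}. x l ^ (e(i := Suc (e i))) l) = (\<Prod>l\<in>I-{i}. x l ^ e l)"
        by (intro prod.cong) auto
      ultimately show ?thesis by simp
    qed
    have "(\<lambda>x. (\<Sum>e\<in>E. \<kappa> e * mono (e(i := Suc (e i))) x) + (- s) * f x) \<in> W"
      by (intro add scale sum finE mono_W f)
    then show ?thesis
    proof (rule cong)
      fix x assume "x \<in> Z"
      then have "x i * f x = (\<Sum>e\<in>E. \<kappa> e * mono (e(i := Suc (e i))) x)"
        using \<kappa> by (simp add: sum_distrib_left mult.left_commute flip: var)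
      then show "(x i - s) * f x = (\<Sum>e\<in>E. \<kappa> e * mono (e(i := Suc (e i))) x) + (- s) * f x"
        by (simp add: left_diff_distrib)
    qed
  qed
  have one: "(\<lambda>x. 1) \<in> W" using mono_W[of "\<lambda>_. 0"] by (simp add: mono_def[abs_def])
  have delta: "(\<lambda>x. if x = z then 1 else 0) \<in> W" if z: "z \<in> Z" for z
  proof -
    \<comment> \<open>With \<open>T\<close> the set of all pairs \<open>(i, s)\<close> with
      \<open>s\<close> different from \<open>z i\<close>, this product vanishes at every point of
      the box except \<open>z\<close>. Scaled to 1 at \<open>z\<close>, it is the indicator of
      \<open>z\<close>.\<close>
    define P where "P T x = (\<Prod>(i,s)\<in>T. x i - s)" for T :: "('i \<times> 'a) set" and x :: "'i \<Rightarrow> 'a"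
    have P_W: "P T \<in> W" if "finite T" "T \<subseteq> I \<times> UNIV" for T
      using that
    proof (induction T rule: finite_induct)
      case empty
      then show ?case using one by (simp add: P_def[abs_def])
    next
      case (insert p T)
      obtain i s where p: "p = (i, s)" by (cases p)
      have "P (insert p T) = (\<lambda>x. (x i - s) * P T x)"
        using insert.hyps by (simp add: P_def[abs_def] p)
      then show ?case using insert by (simp add: mult_var p)
    qed
    let ?T = "(SIGMA i:I. - {z i})"
    have finT: "finite ?T" using I by auto
    have "(\<lambda>x. inverse (P ?T z) * P ?T x) \<in> W" using finT by (intro scale P_W) auto
    then show ?thesis
    proof (rule cong)
      fix x assume x: "x \<in> Z"
      have nz: "P ?T z \<noteq> 0" using finT unfolding P_def by (auto simp: prod_zero_iff)
      have "P ?T x = 0" if ne: "x \<noteq> z"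
      proof -
        have "\<exists>i\<in>I. x i \<noteq> z i"
          using ne x z Z by (metis PiE_ext subsetD)
        then show ?thesis unfolding P_def using finT by (subst prod_zero_iff) force+
      qed
      then show "(if x = z then 1 else 0) = inverse (P ?T z) * P ?T x" using nz by auto
    qed
  qed
  have all: "f \<in> W" for f
  proof -
    have "(\<lambda>x. \<Sum>z\<in>Z. f z * (if x = z then 1 else 0)) \<in> W"
      by (intro sum finZ scale delta)
    then show ?thesis by (rule cong) (simp add: finZ if_distrib cong: if_cong)
  qed
  let ?q = "CARD('a)"
  \<comment> \<open>Coefficient vectors on \<open>E\<close> map onto the functions on
    \<open>Z\<close>, so \<open>q ^ card Z \<le> q ^ card E\<close>.\<close>
  have "PiE Z (\<lambda>_. UNIV) \<subseteq>
      (\<lambda>\<kappa>. restrict (\<lambda>x. \<Sum>e\<in>E. \<kappa> e * mono e x) Z) ` PiE E (\<lambda>_. UNIV :: 'a set)"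
  proof
    fix f :: "('i \<Rightarrow> 'a) \<Rightarrow> 'a" assume f: "f \<in> PiE Z (\<lambda>_. UNIV)"
    obtain \<kappa> where \<kappa>: "\<forall>x\<in>Z. f x = (\<Sum>e\<in>E. \<kappa> e * mono e x)" using all[of f] unfolding W_def by blast
    have "f = restrict (\<lambda>x. \<Sum>e\<in>E. restrict \<kappa> E e * mono e x) Z"
      using f \<kappa> by (intro ext) (auto simp: PiE_def extensional_def)
    then show "f \<in> (\<lambda>\<kappa>. restrict (\<lambda>x. \<Sum>e\<in>E. \<kappa> e * mono e x) Z) ` PiE E (\<lambda>_. UNIV :: 'a set)"
      by (intro image_eqI[of _ _ "restrict \<kappa> E"]) auto
  qed
  then have "card (PiE Z (\<lambda>_. UNIV :: 'a set)) \<le> card (PiE E (\<lambda>_. UNIV :: 'a set))"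
    by (rule surj_card_le[rotated]) (intro finite_PiE finE finite)
  then have "?q ^ card Z \<le> ?q ^ card E" using finE finZ by (simp add: card_PiE)
  moreover have "?q > 1"
    using card_mono[of "UNIV :: 'a set" "{0, 1}"] by simp
  ultimately have "card Z \<le> card E" by simp
  then show ?thesis using I by (simp add: E_def card_PiE)
qed

section \<open>Linear algebra of hypothesis (H)\<close>

text \<open>The vector \<open>u\<close> is annihilated by the transpose of the square submatrix on
  the columns \<open>S\<close>, whose determinant is nonzero by full rank.\<close>

lemma hyp_H_injective:
  fixes A :: "nat \<Rightarrow> nat \<Rightarrow> 'a::field"
  assumes H: "hyp_H n t A" and S: "S \<subseteq> {1..t}" "card S = n"
    and zero: "\<And>i. i \<in> S \<Longrightarrow> (\<Sum>j=1..n. u j * A j i) = 0" and j: "j \<in> {1..n}"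
  shows "u j = 0"
proof -
  define M where "M = submat_cols n A S"
  have M: "M \<in> carrier_mat n n" by (simp add: M_def submat_cols_def)
  have "vec_space.rank n M = n" using H S unfolding hyp_H_def M_def by blast
  then have "det M \<noteq> 0" using vec_space.det_rank_iff[OF M] by simp
  then have "det (transpose_mat M) \<noteq> 0" using M by (simp add: det_transpose)
  moreover have MT: "transpose_mat M \<in> carrier_mat n n" using M by simp
  ultimately have ker: "w = 0\<^sub>v n" if "w \<in> carrier_vec n" "transpose_mat M *\<^sub>v w = 0\<^sub>v n" for w
    using det_0_iff_vec_prod_zero_field[OF MT] that by blast
  \<comment> \<open>Matrix library vectors are indexed from 0, whereas \<open>u\<close> is indexed
    from 1.\<close>
  define w where "w = vec n (\<lambda>k. u (Suc k))"
  have finS: "finite S" using S(1) finite_subset by blast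
  have "transpose_mat M *\<^sub>v w = 0\<^sub>v n"
  proof (rule eq_vecI)
    fix i assume "i < dim_vec (0\<^sub>v n :: 'a vec)"
    then have i: "i < n" by simp
    let ?s = "sorted_list_of_set S ! i"
    have s: "?s \<in> S" using i S(2) finS by (metis nth_mem set_sorted_list_of_set length_sorted_list_of_set)
    have "(transpose_mat M *\<^sub>v w) $ i = (\<Sum>k = 0..<n. A (k + 1) ?s * u (Suc k))"
      using i M by (simp add: scalar_prod_def w_def M_def submat_cols_def)
    also have "\<dots> = (\<Sum>j=1..n. u j * A j ?s)"
      by (rule sum.reindex_bij_witness[of _ "\<lambda>j. j - 1" Suc]) auto
    finally show "(transpose_mat M *\<^sub>v w) $ i = 0\<^sub>v n $ i" using zero[OF s] i by simp
  qed (use M in simp)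
  moreover have "w \<in> carrier_vec n" by (simp add: w_def)
  ultimately have "w = 0\<^sub>v n" by (rule ker[rotated])
  moreover have "j - 1 < n" using j by auto
  ultimately have "w $ (j - 1) = 0" by simp
  then show ?thesis using j \<open>j - 1 < n\<close> by (simp add: w_def)
qed

text \<open>Any \<open>n\<close> of the linear forms are coordinates for \<open>u\<close>: the
  difference of two vectors with equal values is killed by all \<open>n\<close> forms. This serves
  both to count common zeros and to invert the first \<open>n\<close> columns.\<close>

lemma hyp_H_inj_on:
  fixes A :: "nat \<Rightarrow> nat \<Rightarrow> 'a::field"
  assumes H: "hyp_H n t A" and S: "S \<subseteq> {1..t}" "card S = n"
  shows "inj_on (\<lambda>u. \<lambda>i\<in>S. \<Sum>j=1..n. u j * A j i) (PiE {1..n} (\<lambda>_. UNIV))"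
proof (rule inj_onI)
  fix u u' :: "nat \<Rightarrow> 'a"
  assume u: "u \<in> PiE {1..n} (\<lambda>_. UNIV)" "u' \<in> PiE {1..n} (\<lambda>_. UNIV)"
    and eq: "(\<lambda>i\<in>S. \<Sum>j=1..n. u j * A j i) = (\<lambda>i\<in>S. \<Sum>j=1..n. u' j * A j i)"
  have "(\<Sum>j=1..n. (u j - u' j) * A j i) = 0" if "i \<in> S" for i
    using fun_cong[OF eq, of i] that by (simp add: left_diff_distrib sum_subtractf)
  then have "u j - u' j = 0" if "j \<in> {1..n}" for j
    using hyp_H_injective[OF H S, of "\<lambda>j. u j - u' j" j] that by blast
  then show "u = u'" using u by (intro PiE_ext) auto
qed

text \<open>Extending \<open>I\<close> to \<open>n\<close> columns \<open>S\<close>, a kernel vector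
  is determined by its forms on \<open>S\<close>, and these are free only on
  \<open>S - I\<close>.\<close>

lemma hyp_H_card_kernel_le:
  fixes A :: "nat \<Rightarrow> nat \<Rightarrow> 'a::{finite,field}"
  assumes H: "hyp_H n t A" and nt: "n \<le> t" and I: "I \<subseteq> {1..t}" "card I \<le> n"
  shows "card {u \<in> PiE {1..n} (\<lambda>_. UNIV). \<forall>i\<in>I. (\<Sum>j=1..n. u j * A j i) = 0} \<le> CARD('a) ^ (n - card I)"
    (is "card ?K \<le> _")
proof -
  obtain S where S: "I \<subseteq> S" "S \<subseteq> {1..t}" "card S = n"
    using exists_subset_between[of I n "{1..t}"] I nt by auto
  have finS: "finite S" using S finite_subset by blast
  let ?T = "PiE S (\<lambda>i. if i \<in> I then {0::'a} else UNIV)"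
  have "card ?K \<le> card ?T"
  proof (rule card_inj_on_le)
    show "inj_on (\<lambda>u. \<lambda>i\<in>S. \<Sum>j=1..n. u j * A j i) ?K"
      by (rule inj_on_subset[OF hyp_H_inj_on[OF H S(2,3)]]) auto
    show "finite ?T" using finS by (intro finite_PiE) auto
  qed auto
  also have "card ?T = (\<Prod>i\<in>S. if i \<in> I then 1 else CARD('a))"
    using finS by (subst card_PiE) (auto intro!: prod.cong)
  also have "\<dots> = CARD('a) ^ card (S - I)"
    using finS by (simp add: prod.If_cases Diff_eq)
  also have "card (S - I) = n - card I"
    using S finS by (simp add: card_Diff_subset finite_subset)
  finally show ?thesis .
qed

text \<open>Inverting the block of the first \<open>n\<close> columns solves the system for the pure
  powers \<open>x i ^ d i\<close>, which is the shape required by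
  \<open>card_solutions_le_prod\<close>.\<close>

lemma hyp_H_fibre_le:
  fixes A :: "nat \<Rightarrow> nat \<Rightarrow> 'a::{finite,field}"
  assumes H: "hyp_H n t A" and nt: "n \<le> t"
    and d: "\<And>i. i \<in> {1..n} \<Longrightarrow> d i > 0"
    and deg: "\<And>i j. i \<in> {1..n} \<Longrightarrow> j \<in> {1..n} \<Longrightarrow> (\<Sum>l=1..n. c j l) < d i"
  shows "card {x \<in> PiE {1..n} (\<lambda>_. UNIV). \<forall>j\<in>{1..n}.
      (\<Sum>i=1..n. A j i * x i ^ d i) - b j * (\<Prod>l=1..n. x l ^ c j l) = w j} \<le> (\<Prod>i=1..n. d i)"
    (is "card ?Z \<le> _")
proof -
  let ?V = "PiE {1..n} (\<lambda>_. UNIV :: 'a set)"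
  let ?L = "\<lambda>u. \<lambda>i\<in>{1..n}. \<Sum>j=1..n. u j * A j i"
  have inj: "inj_on ?L ?V" using nt by (intro hyp_H_inj_on[OF H]) auto
  \<comment> \<open>An injective self-map of a finite set is onto, so the unit vectors have
    preimages. These are the rows \<open>B i\<close> of the inverse block.\<close>
  have "?L ` ?V = ?V"
    by (rule endo_inj_surj[OF _ _ inj]) (auto intro!: finite_PiE)
  have ex: "\<exists>u. ?L u = (\<lambda>l\<in>{1..n}. if l = i then 1 else 0)" for i
  proof -
    have "(\<lambda>l\<in>{1..n}. if l = i then 1 else 0) \<in> ?L ` ?V"
      unfolding \<open>?L ` ?V = ?V\<close> by auto
    then obtain u where "(\<lambda>l\<in>{1..n}. if l = i then 1 else 0) = ?L u" by (rule imageE)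
    then show ?thesis by (intro exI[of _ u]) (rule sym)
  qed
  then have "\<forall>i. \<exists>u. ?L u = (\<lambda>l\<in>{1..n}. if l = i then 1 else 0)" by (intro allI)
  then obtain B where "\<forall>i. ?L (B i) = (\<lambda>l\<in>{1..n}. if l = i then 1 else 0)"
    by (rule choice[THEN exE])
  then have B: "?L (B i) = (\<lambda>l\<in>{1..n}. if l = i then 1 else 0)" for i by blast
  have BA: "(\<Sum>j=1..n. B i j * A j l) = (if l = i then 1 else 0)" if "l \<in> {1..n}" for i l
    using fun_cong[OF B[of i], of l] that by simp
  show ?thesis
  proof (rule card_solutions_le_prod[where J = "{1..n}" and c = c
        and v = "\<lambda>i. \<Sum>j=1..n. B i j * w j" and \<gamma> = "\<lambda>i j. B i j * b j"])
    fix x i assume x: "x \<in> ?Z" and i: "i \<in> {1..n}"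
    \<comment> \<open>Row \<open>i\<close> of the inverse is applied to the fibre equations, with
      the monomials moved to the side of \<open>w\<close>.\<close>
    have "(\<Sum>j=1..n. B i j * (w j + b j * (\<Prod>l=1..n. x l ^ c j l)))
        = (\<Sum>j=1..n. B i j * (\<Sum>l=1..n. A j l * x l ^ d l))"
      using x by (intro sum.cong refl arg_cong2[of _ _ _ _ "(*)"]) (auto simp: algebra_simps)
    also have "\<dots> = (\<Sum>j=1..n. \<Sum>l=1..n. B i j * A j l * x l ^ d l)"
      by (simp add: sum_distrib_left mult.assoc)
    also have "\<dots> = (\<Sum>l=1..n. \<Sum>j=1..n. B i j * A j l * x l ^ d l)" by (rule sum.swap)
    also have "\<dots> = (\<Sum>l=1..n. (if l = i then 1 else 0) * x l ^ d l)"
      by (intro sum.cong refl) (simp only: BA sum_distrib_right[symmetric])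
    also have "\<dots> = x i ^ d i" using i by (simp add: if_distrib[of "\<lambda>z. z * _"] cong: if_cong)
    finally show "x i ^ d i = (\<Sum>j=1..n. B i j * w j) +
        (\<Sum>j=1..n. B i j * b j * (\<Prod>l=1..n. x l ^ c j l))"
      by (simp add: distrib_left sum.distrib mult.assoc)
  qed (use d deg in auto)
qed

section \<open>The character sum for the number of solutions and the moments of its two
  factors\<close>

lemma sum_PiE_split:
  fixes g :: "'i \<Rightarrow> 'b \<Rightarrow> 'c::comm_semiring_1"
  assumes fin: "finite J" "finite B" and disj: "I \<inter> J = {}"
  shows "(\<Sum>x\<in>PiE (I \<union> J) (\<lambda>_. B). f (restrict x I) * (\<Prod>i\<in>J. g i (x i))) =
    (\<Sum>x\<in>PiE I (\<lambda>_. B). f x) * (\<Prod>i\<in>J. \<Sum>y\<in>B. g i y)"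
proof -
  have "(\<Sum>x\<in>PiE I (\<lambda>_. B). f x) * (\<Prod>i\<in>J. \<Sum>y\<in>B. g i y) =
      (\<Sum>x\<in>PiE I (\<lambda>_. B). f x) * (\<Sum>y\<in>PiE J (\<lambda>_. B). \<Prod>i\<in>J. g i (y i))"
    using fin by (simp add: prod_sum_PiE)
  also have "\<dots> = (\<Sum>(x, y)\<in>PiE I (\<lambda>_. B) \<times> PiE J (\<lambda>_. B). f x * (\<Prod>i\<in>J. g i (y i)))"
    by (simp add: sum_product sum.cartesian_product)
  \<comment> \<open>The glued function takes the value \<open>y i\<close> everywhere off
    \<open>I\<close>, which is undefined outside \<open>J\<close>, so it is again extensional on
    \<open>I \<union> J\<close>.\<close>
  also have "\<dots> = (\<Sum>x\<in>PiE (I \<union> J) (\<lambda>_. B). f (restrict x I) * (\<Prod>i\<in>J. g i (x i)))"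
  proof (rule sum.reindex_bij_witness[of _ "\<lambda>x. (restrict x I, restrict x J)"
        "\<lambda>(x, y) i. if i \<in> I then x i else y i"], goal_cases)
    case (1 p)
    then show ?case using disj
      by (auto simp: fun_eq_iff restrict_def PiE_def extensional_def)
  next
    case (2 p)
    then show ?case using disj by (auto simp: PiE_def extensional_def)
  next
    case (3 x)
    then show ?case
      by (auto simp: fun_eq_iff PiE_def extensional_def)
  next
    case (4 x)
    then show ?case by auto
  next
    case (5 p)
    obtain x y where p: "p = (x, y)" by (cases p)
    have "restrict (\<lambda>i. if i \<in> I then x i else y i) I = x"
      using 5 p by (auto simp: fun_eq_iff PiE_def extensional_def)
    moreover have "(\<Prod>i\<in>J. g i (if i \<in> I then x i else y i)) = (\<Prod>i\<in>J. g i (y i))"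
      using disj by (intro prod.cong) auto
    ultimately show ?case by (simp add: p)
  qed
  finally show ?thesis by simp
qed

context additive_character
begin

text \<open>The monomials involve only the first \<open>n\<close> variables. Each later variable
  therefore enters the phase only through its own power, with coefficient the linear form of its
  column, and its sum splits off as a factor.\<close>

lemma count_eq_character_sum:
  fixes A :: "nat \<Rightarrow> nat \<Rightarrow> 'a"
  assumes nt: "n \<le> t"
  shows "of_nat CARD('a) ^ n * of_nat (num_solutions n t A d a b c) =
    (\<Sum>u\<in>PiE {1..n} (\<lambda>_. UNIV). \<psi> (\<Sum>j=1..n. u j * a j) *
      (\<Sum>x\<in>PiE {1..n} (\<lambda>_. UNIV). \<psi> (\<Sum>j=1..n. u j *
        ((\<Sum>i=1..n. A j i * x i ^ d i) - b j * (\<Prod>i=1..n. x i ^ c j i)))) *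
      (\<Prod>i=n+1..t. \<Sum>y\<in>UNIV. \<psi> ((\<Sum>j=1..n. u j * A j i) * y ^ d i)))"
    (is "?lhs = (\<Sum>u\<in>?V. ?a u * (\<Sum>x\<in>?V. \<psi> (?F u x)) * (\<Prod>i=n+1..t. \<Sum>y\<in>UNIV. ?g u i y))")
proof -
  let ?X = "PiE {1..t} (\<lambda>_. UNIV :: 'a set)"
  let ?v = "\<lambda>x j. (\<Sum>i=1..t. A j i * x i ^ d i) + a j - b j * (\<Prod>i=1..n. x i ^ c j i)"
  have finX: "finite ?X" by (intro finite_PiE) auto
  have range: "{1..t} = {1..n} \<union> {n+1..t}" using nt by auto
  have split: "\<psi> (\<Sum>j=1..n. u j * ?v x j) =
      ?a u * (\<psi> (?F u (restrict x {1..n})) * (\<Prod>i=n+1..t. ?g u i (x i)))" for u x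
  proof -
    have "(\<Sum>j=1..n. u j * (\<Sum>i=n+1..t. A j i * x i ^ d i)) =
        (\<Sum>j=1..n. \<Sum>i=n+1..t. u j * A j i * x i ^ d i)"
      by (simp add: sum_distrib_left mult.assoc)
    also have "\<dots> = (\<Sum>i=n+1..t. \<Sum>j=1..n. u j * A j i * x i ^ d i)" by (rule sum.swap)
    finally have swap: "(\<Sum>j=1..n. u j * (\<Sum>i=n+1..t. A j i * x i ^ d i)) =
        (\<Sum>i=n+1..t. (\<Sum>j=1..n. u j * A j i) * x i ^ d i)"
      by (simp add: sum_distrib_right)
    have F: "?F u (restrict x {1..n}) = ?F u x" by simp
    have "?v x j = a j + (((\<Sum>i=1..n. A j i * x i ^ d i) - b j * (\<Prod>i=1..n. x i ^ c j i))
        + (\<Sum>i=n+1..t. A j i * x i ^ d i))" for j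
      unfolding range by (subst sum.union_disjoint) auto
    then have "(\<Sum>j=1..n. u j * ?v x j) = (\<Sum>j=1..n. u j * a j) + (?F u x +
        (\<Sum>i=n+1..t. (\<Sum>j=1..n. u j * A j i) * x i ^ d i))"
      by (simp only: distrib_left sum.distrib swap)
    then show ?thesis by (simp only: add F sum_eq_prod[of _ "{n+1..t}"])
  qed
  have "?lhs = (\<Sum>x\<in>?X. if \<forall>j\<in>{1..n}. ?v x j = 0 then of_nat CARD('a) ^ n else 0)"
    using finX by (simp add: num_solutions_def sum.If_cases Int_def)
  also have "\<dots> = (\<Sum>x\<in>?X. \<Sum>u\<in>?V. \<psi> (\<Sum>j=1..n. u j * ?v x j))"
    by (intro sum.cong refl) (simp only: orthogonality_PiE finite_atLeastAtMost card_atLeastAtMost diff_Suc_1 diff_add_inverse2)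
  also have "\<dots> = (\<Sum>u\<in>?V. \<Sum>x\<in>?X. \<psi> (\<Sum>j=1..n. u j * ?v x j))" by (rule sum.swap)
  also have "\<dots> = (\<Sum>u\<in>?V. ?a u * ((\<Sum>x\<in>?V. \<psi> (?F u x)) * (\<Prod>i=n+1..t. \<Sum>y\<in>UNIV. ?g u i y)))"
  proof (rule sum.cong[OF refl])
    fix u
    have "(\<Sum>x\<in>?X. \<psi> (\<Sum>j=1..n. u j * ?v x j)) =
        ?a u * (\<Sum>x\<in>?X. \<psi> (?F u (restrict x {1..n})) * (\<Prod>i=n+1..t. ?g u i (x i)))"
      unfolding split by (simp only: sum_distrib_left)
    also have "(\<Sum>x\<in>?X. \<psi> (?F u (restrict x {1..n})) * (\<Prod>i=n+1..t. ?g u i (x i))) =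
        (\<Sum>x\<in>?V. \<psi> (?F u x)) * (\<Prod>i=n+1..t. \<Sum>y\<in>UNIV. ?g u i y)"
      unfolding range by (rule sum_PiE_split[where f = "\<lambda>x. \<psi> (?F u x)" and g = "?g u"]) auto
    finally show "(\<Sum>x\<in>?X. \<psi> (\<Sum>j=1..n. u j * ?v x j)) =
      ?a u * ((\<Sum>x\<in>?V. \<psi> (?F u x)) * (\<Prod>i=n+1..t. \<Sum>y\<in>UNIV. ?g u i y))" .
  qed
  finally show ?thesis by (simp only: mult.assoc)
qed

text \<open>One factor \<open>q ^ n\<close> comes from orthogonality in \<open>u\<close>, the other
  from the number of points \<open>x\<close>; the product of the degrees is the fibre bound.\<close>

lemma coupled_sum_second_moment:
  fixes A :: "nat \<Rightarrow> nat \<Rightarrow> 'a"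
  assumes H: "hyp_H n t A" and nt: "n \<le> t"
    and d: "\<And>i. i \<in> {1..n} \<Longrightarrow> d i > 0"
    and deg: "\<And>i j. i \<in> {1..n} \<Longrightarrow> j \<in> {1..n} \<Longrightarrow> (\<Sum>l=1..n. c j l) < d i"
  shows "(\<Sum>u\<in>PiE {1..n} (\<lambda>_. UNIV). (norm (\<Sum>x\<in>PiE {1..n} (\<lambda>_. UNIV).
      \<psi> (\<Sum>j=1..n. u j * ((\<Sum>i=1..n. A j i * x i ^ d i) - b j * (\<Prod>i=1..n. x i ^ c j i)))))\<^sup>2)
    \<le> real CARD('a) ^ (2 * n) * real (\<Prod>i=1..n. d i)"
proof -
  let ?V = "PiE {1..n} (\<lambda>_. UNIV :: 'a set)"
  let ?F = "\<lambda>j x. (\<Sum>i=1..n. A j i * x i ^ d i) - b j * (\<Prod>i=1..n. x i ^ c j i)"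
  have "(\<Sum>u\<in>?V. (norm (\<Sum>x\<in>?V. \<psi> (\<Sum>j=1..n. u j * ?F j x)))\<^sup>2)
      \<le> real CARD('a) ^ n * real (\<Prod>i=1..n. d i) * real (card ?V)"
  proof (rule second_moment_le[where R = "\<lambda>x y. \<forall>j\<in>{1..n}. ?F j y = ?F j x"])
    fix x y
    have "(\<Sum>u\<in>?V. \<psi> ((\<Sum>j=1..n. u j * ?F j x) - (\<Sum>j=1..n. u j * ?F j y))) =
        (\<Sum>u\<in>?V. \<psi> (\<Sum>j=1..n. u j * (?F j x - ?F j y)))"
      by (simp only: right_diff_distrib[of _ "?F _ x"] sum_subtractf)
    also have "\<dots> = (if \<forall>j\<in>{1..n}. ?F j x - ?F j y = 0 then of_nat CARD('a) ^ n else 0)"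
      by (subst orthogonality_PiE) simp_all
    also have "\<dots> = of_real (if \<forall>j\<in>{1..n}. ?F j y = ?F j x then real CARD('a) ^ n else 0)"
    proof -
      have "(\<forall>j\<in>{1..n}. ?F j x - ?F j y = 0) \<longleftrightarrow> (\<forall>j\<in>{1..n}. ?F j y = ?F j x)"
        unfolding right_minus_eq by (intro ball_cong refl eq_commute)
      moreover have "(if Q then of_nat CARD('a) ^ n else 0) =
          complex_of_real (if Q then real CARD('a) ^ n else 0)" for Q by simp
      ultimately show ?thesis by (simp only:)
    qed
    finally show "(\<Sum>u\<in>?V. \<psi> ((\<Sum>j=1..n. u j * ?F j x) - (\<Sum>j=1..n. u j * ?F j y))) =
      of_real (if \<forall>j\<in>{1..n}. ?F j y = ?F j x then real CARD('a) ^ n else 0)" .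
  next
    fix x
    show "card {y \<in> ?V. \<forall>j\<in>{1..n}. ?F j y = ?F j x} \<le> (\<Prod>i=1..n. d i)"
      using d deg by (rule hyp_H_fibre_le[OF H nt])
  qed (auto intro!: finite_PiE)
  also have "\<dots> = real CARD('a) ^ (2 * n) * real (\<Prod>i=1..n. d i)"
    by (simp add: card_PiE mult_2 power_add)
  finally show ?thesis .
qed

text \<open>The vectors \<open>u\<close> are sorted by the set \<open>I\<close> of columns beyond
  \<open>n\<close> whose form vanishes. A class has at most \<open>q ^ (n - card I)\<close> members,
  and each vanishing form costs one extra factor \<open>q\<close>, so every class contributes at
  most \<open>C ^ (t - n) * q ^ t\<close>. There are \<open>2 ^ (t - n)\<close> classes.\<close>

lemma product_sum_second_moment:
  fixes A :: "nat \<Rightarrow> nat \<Rightarrow> 'a"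
  assumes H: "hyp_H n t A" and nt: "n \<le> t"
    and d: "\<And>i. i \<in> {n+1..t} \<Longrightarrow> 0 < d i \<and> d i \<le> \<delta>" and \<delta>: "\<delta> > 0"
  shows "(\<Sum>u\<in>PiE {1..n} (\<lambda>_. UNIV) - {\<lambda>j\<in>{1..n}. 0}.
      (norm (\<Prod>i=n+1..t. \<Sum>y\<in>UNIV. \<psi> ((\<Sum>j=1..n. u j * A j i) * y ^ d i)))\<^sup>2)
    \<le> real CARD('a) ^ t * (2 * real \<delta>) ^ (2 * (t - n))"
proof -
  let ?V = "PiE {1..n} (\<lambda>_. UNIV :: 'a set)" and ?M = "{n+1..t}"
  let ?U = "?V - {\<lambda>j\<in>{1..n}. 0}"
  define q where "q = real CARD('a)"
  define C where "C = 2 * (real \<delta>)\<^sup>2"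
  define L where "L u i = (\<Sum>j=1..n. u j * A j i)" for u i
  define Z where "Z u = {i\<in>?M. L u i = 0}" for u
  define P where "P u = (norm (\<Prod>i\<in>?M. \<Sum>y\<in>UNIV. \<psi> (L u i * y ^ d i)))\<^sup>2" for u
  have finV: "finite ?V" by (intro finite_PiE) auto
  then have finU: "finite ?U" by simp
  have q: "q \<ge> 1" by (simp add: q_def Suc_leI)
  have "real \<delta> \<ge> 1" using \<delta> by simp
  then have "(real \<delta>)\<^sup>2 \<ge> 1" by simp
  then have C: "C \<ge> 1" by (simp add: C_def)
  \<comment> \<open>Any \<open>n\<close> vanishing forms would already force \<open>u\<close> to be
    zero.\<close>
  have Z_le: "card (Z u) \<le> n" if u: "u \<in> ?U" for u
  proof (rule ccontr)
    assume "\<not> card (Z u) \<le> n"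
    then obtain S where S: "S \<subseteq> Z u" "card S = n" by (metis nat_le_linear obtain_subset_with_card_n)
    have "u j = 0" if "j \<in> {1..n}" for j
      by (rule hyp_H_injective[OF H _ S(2) _ that]) (use S(1) in \<open>auto simp: Z_def L_def\<close>)
    then have "u = (\<lambda>j\<in>{1..n}. 0)" using u by (auto simp: fun_eq_iff PiE_def extensional_def)
    then show False using u by simp
  qed
  have P_le: "P u \<le> C ^ (t - n) * q ^ (t - n) * q ^ card (Z u)" for u
  proof -
    have "P u = (\<Prod>i\<in>?M. (norm (\<Sum>y\<in>UNIV. \<psi> (L u i * y ^ d i)))\<^sup>2)"
      by (simp add: P_def prod_norm[symmetric] prod_power_distrib)
    \<comment> \<open>A vanishing form gives the trivial sum of squared size \<open>q * q\<close>;
      otherwise \<open>power_sum_bound\<close> gives \<open>C * q\<close>.\<close>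
    also have "\<dots> \<le> (\<Prod>i\<in>?M. C * q * (if i \<in> Z u then q else 1))"
    proof (intro prod_mono conjI zero_le_power2)
      fix i assume i: "i \<in> ?M"
      show "(norm (\<Sum>y\<in>UNIV. \<psi> (L u i * y ^ d i)))\<^sup>2 \<le> C * q * (if i \<in> Z u then q else 1)"
      proof (cases "i \<in> Z u")
        case True
        then have "(norm (\<Sum>y\<in>UNIV. \<psi> (L u i * y ^ d i)))\<^sup>2 = 1 * (q * q)"
          by (simp add: Z_def q_def power2_eq_square)
        also have "\<dots> \<le> C * (q * q)" using C q by (intro mult_right_mono) auto
        finally show ?thesis using True by (simp add: mult.assoc)
      next
        case False
        then have "L u i \<noteq> 0" using i by (simp add: Z_def)
        then have "(norm (\<Sum>y\<in>UNIV. \<psi> (L u i * y ^ d i)))\<^sup>2 \<le> 2 * (real (d i))\<^sup>2 * q"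
          using power_sum_bound d[OF i] unfolding q_def by blast
        also have "\<dots> \<le> C * q"
          using d[OF i] q unfolding C_def by (intro mult_right_mono mult_left_mono power_mono) auto
        finally show ?thesis using False by simp
      qed
    qed
    also have "\<dots> = (C * q) ^ (t - n) * q ^ card (?M \<inter> Z u)"
      using nt by (simp add: prod.distrib prod.If_cases)
    also have "?M \<inter> Z u = Z u" by (auto simp: Z_def)
    finally show ?thesis by (simp add: power_mult_distrib)
  qed
  have class_le: "(\<Sum>u\<in>{u\<in>?U. Z u = I}. P u) \<le> C ^ (t - n) * q ^ t" if I: "I \<in> Pow ?M" for I
  proof (cases "card I \<le> n")
    case True
    have "(\<Sum>u\<in>{u\<in>?U. Z u = I}. P u) \<le> (\<Sum>u\<in>{u\<in>?U. Z u = I}. C ^ (t - n) * q ^ (t - n) * q ^ card I)"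
      using P_le by (intro sum_mono) auto
    also have "\<dots> = real (card {u\<in>?U. Z u = I}) * (C ^ (t - n) * q ^ (t - n) * q ^ card I)" by simp
    also have "\<dots> \<le> q ^ (n - card I) * (C ^ (t - n) * q ^ (t - n) * q ^ card I)"
    proof (intro mult_right_mono)
      have "card {u\<in>?U. Z u = I} \<le> card {u \<in> ?V. \<forall>i\<in>I. (\<Sum>j=1..n. u j * A j i) = 0}"
        using finV by (intro card_mono) (auto intro: finite_subset[of _ ?V] simp: Z_def L_def)
      also have "\<dots> \<le> CARD('a) ^ (n - card I)"
        using I True by (intro hyp_H_card_kernel_le[OF H nt]) auto
      finally show "real (card {u\<in>?U. Z u = I}) \<le> q ^ (n - card I)"
        unfolding q_def of_nat_power[symmetric] of_nat_le_iff .
    qed (use q C in auto)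
    also have "\<dots> = C ^ (t - n) * (q ^ (n - card I) * q ^ (t - n) * q ^ card I)" by (simp only: mult_ac)
    also have "q ^ (n - card I) * q ^ (t - n) * q ^ card I = q ^ t"
      using True nt by (simp flip: power_add)
    finally show ?thesis .
  next
    case False
    then have "{u\<in>?U. Z u = I} = {}" using Z_le by blast
    then have "(\<Sum>u\<in>{u\<in>?U. Z u = I}. P u) = 0" by (simp only: sum.empty)
    then show ?thesis using q C by simp
  qed
  have "(\<Sum>u\<in>?U. P u) = (\<Sum>I\<in>Pow ?M. \<Sum>u\<in>{u\<in>?U. Z u = I}. P u)"
    using finU by (intro sum.group[symmetric]) (auto simp: Z_def)
  also have "\<dots> \<le> (\<Sum>I\<in>Pow ?M. C ^ (t - n) * q ^ t)" by (intro sum_mono class_le)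
  also have "\<dots> = 2 ^ (t - n) * C ^ (t - n) * q ^ t" by (simp add: card_Pow)
  \<comment> \<open>The number of classes is absorbed into the constant through
    \<open>2 * C = (2 * \<delta>)\<^sup>2\<close>.\<close>
  also have "2 ^ (t - n) * C ^ (t - n) = ((2 * real \<delta>)\<^sup>2) ^ (t - n)"
    unfolding power_mult_distrib[symmetric] by (simp add: C_def power2_eq_square)
  also have "((2 * real \<delta>)\<^sup>2) ^ (t - n) * q ^ t = q ^ t * (2 * real \<delta>) ^ (2 * (t - n))"
    by (simp only: power_mult mult.commute[of _ "q ^ t"])
  finally show ?thesis unfolding P_def L_def q_def .
qed

section \<open>Cauchy-Schwarz and the final estimate\<close>

lemma count_deviation_bound:
  fixes A :: "nat \<Rightarrow> nat \<Rightarrow> 'a"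
  assumes H: "hyp_H n t A" and nt: "n \<le> t"
    and d: "\<And>i. i \<in> {1..t} \<Longrightarrow> 0 < d i \<and> d i \<le> \<delta>" and \<delta>: "\<delta> > 0"
    and deg: "\<And>i j. i \<in> {1..n} \<Longrightarrow> j \<in> {1..n} \<Longrightarrow> (\<Sum>l=1..n. c j l) < d i"
  shows "(real (num_solutions n t A d a b c) - real CARD('a) ^ (t - n))\<^sup>2
    \<le> real CARD('a) ^ t * (2 * real \<delta>) ^ (2 * t)"
proof -
  let ?V = "PiE {1..n} (\<lambda>_. UNIV :: 'a set)"
  let ?z = "\<lambda>j\<in>{1..n}. 0 :: 'a"
  let ?U = "?V - {?z}"
  define q where "q = real CARD('a)"
  define N where "N = real (num_solutions n t A d a b c)"
  define S where "S u = (\<Sum>x\<in>?V. \<psi> (\<Sum>j=1..n. u j *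
    ((\<Sum>i=1..n. A j i * x i ^ d i) - b j * (\<Prod>i=1..n. x i ^ c j i))))" for u
  define P where "P u = (\<Prod>i=n+1..t. \<Sum>y\<in>UNIV. \<psi> ((\<Sum>j=1..n. u j * A j i) * y ^ d i))" for u
  have finV: "finite ?V" by (intro finite_PiE) auto
  have q: "q \<ge> 1" by (simp add: q_def Suc_leI)
  have "of_real (q ^ n * N) = (\<Sum>u\<in>?V. \<psi> (\<Sum>j=1..n. u j * a j) * S u * P u)"
    using count_eq_character_sum[OF nt, of A d a b c] by (simp add: q_def N_def S_def P_def)
  also have "\<dots> = \<psi> (\<Sum>j=1..n. ?z j * a j) * S ?z * P ?z +
      (\<Sum>u\<in>?U. \<psi> (\<Sum>j=1..n. u j * a j) * S u * P u)"
    using finV by (intro sum.remove) auto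
  \<comment> \<open>At \<open>u = 0\<close> all character values are 1, so both sums merely count
    points; this is the main term.\<close>
  also have "\<psi> (\<Sum>j=1..n. ?z j * a j) * S ?z * P ?z = of_real (q ^ n * q ^ (t - n))"
  proof -
    have "\<psi> (\<Sum>j=1..n. ?z j * a j) = 1" by simp
    moreover have "S ?z = of_real (q ^ n)" by (simp add: S_def q_def card_PiE)
    moreover have "P ?z = of_real (q ^ (t - n))" by (simp add: P_def q_def)
    ultimately show ?thesis by simp
  qed
  finally have "of_real (q ^ n * (N - q ^ (t - n))) =
      (\<Sum>u\<in>?U. \<psi> (\<Sum>j=1..n. u j * a j) * S u * P u)"
    by (simp only: right_diff_distrib of_real_diff add_diff_cancel_left')
  then have "norm (complex_of_real (q ^ n * (N - q ^ (t - n)))) \<le> (\<Sum>u\<in>?U. norm (S u) * norm (P u))"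
    by (simp only:) (rule order_trans[OF norm_sum], simp add: norm_mult)
  then have "\<bar>q ^ n * (N - q ^ (t - n))\<bar> \<le> (\<Sum>u\<in>?U. norm (S u) * norm (P u))"
    by (simp only: norm_of_real)
  from power_mono[OF this abs_ge_zero, of 2]
  have "(q ^ n * (N - q ^ (t - n)))\<^sup>2 \<le> (\<Sum>u\<in>?U. norm (S u) * norm (P u))\<^sup>2"
    by (simp only: power2_abs)
  also have "\<dots> \<le> (\<Sum>u\<in>?U. (norm (S u))\<^sup>2) * (\<Sum>u\<in>?U. (norm (P u))\<^sup>2)"
    by (rule Cauchy_Schwarz_ineq_sum)
  also have "\<dots> \<le> (q ^ (2 * n) * real \<delta> ^ n) * (q ^ t * (2 * real \<delta>) ^ (2 * (t - n)))"
  proof (rule mult_mono)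
    have "(\<Sum>u\<in>?U. (norm (S u))\<^sup>2) \<le> (\<Sum>u\<in>?V. (norm (S u))\<^sup>2)"
      using finV by (intro sum_mono2) auto
    also have "\<dots> \<le> q ^ (2 * n) * real (\<Prod>i=1..n. d i)"
      unfolding S_def q_def using d nt deg
      by (intro coupled_sum_second_moment[OF H nt]) auto
    also have "\<dots> \<le> q ^ (2 * n) * real \<delta> ^ n"
    proof (intro mult_left_mono)
      have "(\<Prod>i=1..n. d i) \<le> (\<Prod>i=1..n. \<delta>)" using d nt by (intro prod_mono) auto
      then have "(\<Prod>i=1..n. d i) \<le> \<delta> ^ n" by simp
      then show "real (\<Prod>i=1..n. d i) \<le> real \<delta> ^ n"
        unfolding of_nat_power[symmetric] of_nat_le_iff .
    qed (use q in simp)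
    finally show "(\<Sum>u\<in>?U. (norm (S u))\<^sup>2) \<le> q ^ (2 * n) * real \<delta> ^ n" .
    show "(\<Sum>u\<in>?U. (norm (P u))\<^sup>2) \<le> q ^ t * (2 * real \<delta>) ^ (2 * (t - n))"
      unfolding P_def q_def using d by (intro product_sum_second_moment[OF H nt _ \<delta>]) auto
  qed (use q in \<open>auto intro!: sum_nonneg\<close>)
  \<comment> \<open>The factor \<open>\<delta> ^ n\<close> is enlarged so that the powers of
    \<open>2 * \<delta>\<close> combine to the exponent \<open>2 * t\<close>. The factor
    \<open>q ^ (2 * n)\<close> later cancels against the one on the left.\<close>
  also have "\<dots> \<le> (q ^ (2 * n) * (2 * real \<delta>) ^ (2 * n)) * (q ^ t * (2 * real \<delta>) ^ (2 * (t - n)))"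
  proof (intro mult_right_mono mult_left_mono)
    have "real \<delta> ^ n \<le> (2 * real \<delta>) ^ n" by (intro power_mono) auto
    also have "\<dots> \<le> (2 * real \<delta>) ^ (2 * n)" using \<delta> by (intro power_increasing) auto
    finally show "real \<delta> ^ n \<le> (2 * real \<delta>) ^ (2 * n)" .
  qed (use q in auto)
  also have "\<dots> = q ^ (2 * n) * (q ^ t * ((2 * real \<delta>) ^ (2 * n) * (2 * real \<delta>) ^ (2 * (t - n))))"
    by (simp only: mult_ac)
  also have "(2 * real \<delta>) ^ (2 * n) * (2 * real \<delta>) ^ (2 * (t - n)) = (2 * real \<delta>) ^ (2 * t)"
  proof -
    have "2 * n + 2 * (t - n) = 2 * t" using nt by simp
    then show ?thesis by (simp only: power_add[symmetric])
  qed
  also have "(q ^ n * (N - q ^ (t - n)))\<^sup>2 = q ^ (2 * n) * (N - q ^ (t - n))\<^sup>2"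
    by (simp add: power_mult_distrib power_mult mult.commute flip: power_mult)
  finally show ?thesis
    using q unfolding N_def q_def by (subst (asm) mult_le_cancel_left_pos) auto
qed

end

text \<open>The square root of the deviation bound, taken with \<open>\<delta> = d 1\<close>, has
  constant \<open>(2 * d 1) ^ t\<close>, which is at most \<open>(6 * n * d 1) ^ (t + 1)\<close>
  because \<open>n\<close> and \<open>d 1\<close> are at least 1.\<close>

theorem mainTheorem13:
  fixes A :: "nat \<Rightarrow> nat \<Rightarrow> 'a::{finite,field}"
    and t n :: nat and d :: "nat \<Rightarrow> nat" and c :: "nat \<Rightarrow> nat \<Rightarrow> nat"
    and a b :: "nat \<Rightarrow> 'a"
  assumes "t > 0" and "n > 0" and "real n < (real t - 1) / 2"
    and "\<And>i. 1 \<le> i \<Longrightarrow> i < t \<Longrightarrow> d i > d (i + 1)"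
    and "d t \<ge> 2"
    and "\<And>i. 1 \<le> i \<Longrightarrow> i \<le> t \<Longrightarrow> \<not> CHAR('a) dvd d i"
    and "\<And>j i. 1 \<le> j \<Longrightarrow> j \<le> n \<Longrightarrow> 1 \<le> i \<Longrightarrow> i \<le> n \<Longrightarrow> c j i > 0"
    and "\<And>j. 1 \<le> j \<Longrightarrow> j \<le> n \<Longrightarrow> (\<Sum>i=1..n. c j i) < d t"
    and "hyp_H n t A"
    and "\<exists>j\<in>{1..n}. a j \<noteq> 0"
    and "\<And>j. 1 \<le> j \<Longrightarrow> j \<le> n \<Longrightarrow> b j \<noteq> 0"
  shows "\<bar>real (num_solutions n t A d a b c) - real (card (UNIV :: 'a set)) ^ (t - n)\<bar>
           \<le> real (card (UNIV :: 'a set)) powr (real t / 2) * (6 * real n * real (d 1)) ^ (t + 1)"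
proof -
  obtain \<psi> :: "'a \<Rightarrow> complex" where "additive_character \<psi>"
    using additive_character_exists by blast
  then interpret additive_character \<psi> .
  let ?q = "real CARD('a)"
  have nt: "n \<le> t" using assms(3) by simp
  have anti: "d k \<le> d i" if "i \<le> k" "1 \<le> i" "k \<le> t" for i k
    using that
  proof (induction k rule: dec_induct)
    case (step k)
    then show ?case using assms(4)[of k] by fastforce
  qed simp
  have d: "0 < d i \<and> d i \<le> d 1" if "i \<in> {1..t}" for i
    using that anti[of 1 i] anti[of i t] assms(5) by auto
  \<comment> \<open>The degree hypothesis refers to the smallest exponent \<open>d t\<close>;
    monotonicity carries it to every \<open>d i\<close>.\<close>
  have deg: "(\<Sum>l=1..n. c j l) < d i" if "i \<in> {1..n}" "j \<in> {1..n}" for i j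
    using assms(8)[of j] that anti[of i t] nt by fastforce
  have d1: "d 1 > 0" using d[of 1] assms(1) by simp
  have "(real (num_solutions n t A d a b c) - ?q ^ (t - n))\<^sup>2 \<le> ?q ^ t * (2 * real (d 1)) ^ (2 * t)"
    by (rule count_deviation_bound[OF assms(9) nt d d1 deg])
  also have "\<dots> = (?q powr (real t / 2) * (2 * real (d 1)) ^ t)\<^sup>2"
  proof -
    have "?q ^ t = ?q powr (real t / 2 + real t / 2)" by (simp add: powr_realpow)
    also have "\<dots> = (?q powr (real t / 2))\<^sup>2" by (simp only: powr_add power2_eq_square)
    finally show ?thesis by (simp add: power_mult_distrib power_mult mult.commute flip: power_mult)
  qed
  finally have "\<bar>real (num_solutions n t A d a b c) - ?q ^ (t - n)\<bar>
      \<le> ?q powr (real t / 2) * (2 * real (d 1)) ^ t"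
    by (rule abs_le_square_iff[THEN iffD2, THEN order_trans]) simp
  also have "\<dots> \<le> ?q powr (real t / 2) * (6 * real n * real (d 1)) ^ (t + 1)"
  proof (intro mult_left_mono)
    have n1: "real n \<ge> 1" and dd: "real (d 1) \<ge> 1" using assms(2) d1 by auto
    have le: "2 * real (d 1) \<le> 6 * real n * real (d 1)" using n1 dd by (intro mult_right_mono) auto
    have "(2 * real (d 1)) ^ t \<le> (6 * real n * real (d 1)) ^ t" using le by (intro power_mono) auto
    also have "(6 * real n * real (d 1)) ^ t \<le> (6 * real n * real (d 1)) ^ (t + 1)"
      using le dd by (intro power_increasing) linarith+
    finally show "(2 * real (d 1)) ^ t \<le> (6 * real n * real (d 1)) ^ (t + 1)" .
  qed simp
  finally show ?thesis .
qed

end
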